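(* Let $K_T(z,\overline{w})\in\mathscr{S}'(\mathbb{C}^{2d})$ be such that there exists some $H\in L^1(\mathbb{C}^d)$ satisfying $$\big|K_T(z,\overline{w})\big|\le\big|e^{\pi(|z|^2+|w|^2)/2}\big|\cdot H(z-w).$$ Then $K_T$ is a bounded integral operator on all $\mathcal{F}^p(\mathbb{C}^d)$ spaces. In particular it is a bounded operator on the Fock space $\mathcal{F}^2(\mathbb{C}^d)$.
   Context: $|w|^2=\sum_j|w_j|^2$ and $dw$ is Lebesgue measure on $\mathbb{C}^d\cong\mathbb{R}^{2d}$; $\mathscr{S}'$ denotes tempered distributions. For $1\le p\le\infty$, the Sobolev-Fock space $\mathcal{F}^p(\mathbb{C}^d)$ is the space of analytic functions $F$ on $\mathbb{C}^d$ such that $z\mapsto F(z)e^{-\pi|z|^2/2}$ is in $L^p(\mathbb{C}^d)$, normed by the $L^p$ norm of this function. "All $\mathcal{F}^p(\mathbb{C}^d)$ spaces" means all $1\le p\le\infty$. The integral operator with kernel $K_T$ is $F\mapsto\int_{\mathbb{C}^d}F(w)\,K_T(z,\overline{w})\,e^{-\pi|w|^2}\,dw$. The notation comes from the question of which functions $K_T(z,\overline{w})$ are integral kernels of bounded maps on $\mathcal{F}^2(\mathbb{C}^d)$, where $K_T(z,\overline{w})=TK(\cdot,\overline{w})(z)$ for a bounded operator $T$ on $\mathcal{F}^2(\mathbb{C}^d)$ and $K(z,\overline{w})=e^{\pi z\overline{w}}$ is the reproducing kernel of $\mathcal{F}^2(\mathbb{C}^d)$.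
   Formalization: It is additionally assumed that K_T(z, w̄) is analytic in z for almost every w; without this the claim fails, e.g. for K_T(z, w̄)=φ(z)ψ(w) with bump functions φ, ψ, whose operator does not map into analytic functions. *)

theory Defs
  imports "HOL-Analysis.Analysis" "HOL-Probability.Essential_Supremum"
begin

text \<open>
  \<open>\<complex>\<^sup>d\<close> is the type \<^typ>\<open>complex ^ 'd\<close>: its norm is the Euclidean norm and \<^term>\<open>lborel\<close> is
  Lebesgue measure on \<open>\<complex>\<^sup>d \<cong> \<real>\<^sup>2\<^sup>d\<close>. The product type \<^typ>\<open>(complex ^ 'd) \<times> (complex ^ 'd)\<close> is
  \<open>\<complex>\<^sup>2\<^sup>d\<close>.
\<close>

definition vcnj :: "complex ^ 'd \<Rightarrow> complex ^ 'd" where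
  "vcnj w = (\<chi> i. cnj (w $ i))"


subsection \<open>Tempered distributions given by functions\<close>

text \<open>Iterated directional derivative; only meaningful when all the intermediate derivatives exist,
  which \<open>smooth\<close> guarantees.\<close>

fun dir_deriv :: "'a::euclidean_space list \<Rightarrow> ('a \<Rightarrow> complex) \<Rightarrow> 'a \<Rightarrow> complex" where
  "dir_deriv [] f = f"
| "dir_deriv (v # vs) f = (\<lambda>x. frechet_derivative (dir_deriv vs f) (at x) v)"

text \<open>All iterated partial derivatives exist and are Frechet differentiable, i.e. \<open>f\<close> is
  \<open>C\<^sup>\<infinity>\<close> in the real sense.\<close>

definition smooth :: "('a::euclidean_space \<Rightarrow> complex) \<Rightarrow> bool" where
  "smooth f \<longleftrightarrow> (\<forall>vs. set vs \<subseteq> Basis \<longrightarrow> (\<forall>x. dir_deriv vs f differentiable (at x)))"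

definition schwartz :: "('a::euclidean_space \<Rightarrow> complex) set" where
  "schwartz = {f. smooth f \<and>
     (\<forall>vs N. set vs \<subseteq> Basis \<longrightarrow> bdd_above (range (\<lambda>x. (1 + norm x) ^ N * norm (dir_deriv vs f x))))}"

definition schwartz_seminorm :: "nat \<Rightarrow> ('a::euclidean_space \<Rightarrow> complex) \<Rightarrow> real" where
  "schwartz_seminorm N f =
     (\<Sum>vs | set vs \<subseteq> Basis \<and> length vs \<le> N. SUP x. (1 + norm x) ^ N * norm (dir_deriv vs f x))"

definition tempered_distribution :: "(('a::euclidean_space \<Rightarrow> complex) \<Rightarrow> complex) \<Rightarrow> bool" where
  "tempered_distribution u \<longleftrightarrow>
     (\<forall>f\<in>schwartz. \<forall>g\<in>schwartz. u (\<lambda>x. f x + g x) = u f + u g) \<and>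
     (\<forall>f\<in>schwartz. \<forall>c. u (\<lambda>x. c * f x) = c * u f) \<and>
     (\<exists>C N. \<forall>f\<in>schwartz. norm (u f) \<le> C * schwartz_seminorm N f)"

definition test_function :: "('a::euclidean_space \<Rightarrow> complex) \<Rightarrow> bool" where
  "test_function f \<longleftrightarrow> smooth f \<and> compact (closure {x. f x \<noteq> 0})"

text \<open>The function \<open>f\<close> belongs to \<open>\<S>'\<close>. The pairing is required only on compactly supported
  test functions, because for a Schwartz function \<open>\<phi>\<close> the product \<open>f \<phi>\<close> need not be absolutely
  integrable (e.g. \<open>f(x) = e\<^sup>x cos(e\<^sup>x)\<close>); by density this determines the distribution.\<close>

definition tempered_function :: "('a::euclidean_space \<Rightarrow> complex) \<Rightarrow> bool" where
  "tempered_function f \<longleftrightarrow>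
     (\<forall>S. compact S \<longrightarrow> set_integrable lborel S f) \<and>
     (\<exists>u. tempered_distribution u \<and>
        (\<forall>\<phi>. test_function \<phi> \<longrightarrow> u \<phi> = (LINT x|lborel. f x * \<phi> x)))"


subsection \<open>Fock spaces\<close>

text \<open>Analytic on all of \<open>\<complex>\<^sup>d\<close>: everywhere Frechet differentiable with complex-linear derivative.\<close>

definition analytic_Cd :: "(complex ^ 'd \<Rightarrow> complex) \<Rightarrow> bool" where
  "analytic_Cd F \<longleftrightarrow>
     (\<forall>z. \<exists>D. (F has_derivative D) (at z) \<and> (\<forall>c v. D (c *s v) = c * D v))"

text \<open>The exponent \<open>p\<close> ranges over \<^typ>\<open>ennreal\<close>, so that \<open>p = \<infinity>\<close> is included.\<close>

definition in_Lp :: "ennreal \<Rightarrow> ('a::euclidean_space \<Rightarrow> complex) \<Rightarrow> bool" where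
  "in_Lp p f \<longleftrightarrow> f \<in> borel_measurable lborel \<and>
     (if p = \<infinity> then esssup lborel (\<lambda>x. ennreal (norm (f x))) < \<infinity>
      else integrable lborel (\<lambda>x. norm (f x) powr enn2real p))"

definition Lp_norm :: "ennreal \<Rightarrow> ('a::euclidean_space \<Rightarrow> complex) \<Rightarrow> real" where
  "Lp_norm p f =
     (if p = \<infinity> then enn2real (esssup lborel (\<lambda>x. ennreal (norm (f x))))
      else (LINT x|lborel. norm (f x) powr enn2real p) powr (1 / enn2real p))"

definition fock_weighted :: "(complex ^ 'd \<Rightarrow> complex) \<Rightarrow> complex ^ 'd \<Rightarrow> complex" where
  "fock_weighted F = (\<lambda>z. F z * of_real (exp (- pi * (norm z)\<^sup>2 / 2)))"

definition fock_space :: "ennreal \<Rightarrow> (complex ^ 'd \<Rightarrow> complex) set" where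
  "fock_space p = {F. analytic_Cd F \<and> in_Lp p (fock_weighted F)}"

definition fock_norm :: "ennreal \<Rightarrow> (complex ^ 'd \<Rightarrow> complex) \<Rightarrow> real" where
  "fock_norm p F = Lp_norm p (fock_weighted F)"


subsection \<open>Integral operators on Fock spaces\<close>

definition fock_integrand ::
    "((complex ^ 'd) \<times> (complex ^ 'd) \<Rightarrow> complex) \<Rightarrow> (complex ^ 'd \<Rightarrow> complex) \<Rightarrow>
     complex ^ 'd \<Rightarrow> complex ^ 'd \<Rightarrow> complex" where
  "fock_integrand K F z w = F w * K (z, vcnj w) * of_real (exp (- pi * (norm w)\<^sup>2))"

definition fock_operator ::
    "((complex ^ 'd) \<times> (complex ^ 'd) \<Rightarrow> complex) \<Rightarrow> (complex ^ 'd \<Rightarrow> complex) \<Rightarrow>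
     complex ^ 'd \<Rightarrow> complex" where
  "fock_operator K F z = (LINT w|lborel. fock_integrand K F z w)"

text \<open>Since the defining integral is required to converge absolutely at every point, linearity of
  the operator on \<open>fock_space p\<close> is automatic and not listed.\<close>

definition bounded_fock_operator ::
    "ennreal \<Rightarrow> ((complex ^ 'd) \<times> (complex ^ 'd) \<Rightarrow> complex) \<Rightarrow> bool" where
  "bounded_fock_operator p K \<longleftrightarrow>
     (\<forall>F\<in>fock_space p. (\<forall>z. integrable lborel (fock_integrand K F z)) \<and>
        fock_operator K F \<in> fock_space p) \<and>
     (\<exists>C. \<forall>F\<in>fock_space p. fock_norm p (fock_operator K F) \<le> C * fock_norm p F)"


subsection \<open>Hypotheses on the kernel\<close>

text \<open>The function \<open>(z, w) \<mapsto> K(z, v)\<close>, \<open>v\<close> the conjugate of \<open>w\<close>, belongs to \<open>\<S>'\<close>.  Taken literally, and combined with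
  analyticity in \<open>z\<close>, this forces a polynomial in \<open>z\<close> and excludes the reproducing kernel (the
  identity operator), so the Fock-space normalisation, in which the kernel is multiplied by its
  Gaussian weight before being regarded as a tempered distribution, is admitted as well.\<close>

definition tempered_kernel :: "((complex ^ 'd) \<times> (complex ^ 'd) \<Rightarrow> complex) \<Rightarrow> bool" where
  "tempered_kernel K \<longleftrightarrow>
     tempered_function (\<lambda>(z, w). K (z, vcnj w)) \<or>
     tempered_function
       (\<lambda>(z, w). K (z, vcnj w) * of_real (exp (- pi * ((norm z)\<^sup>2 + (norm w)\<^sup>2) / 2)))"

text \<open>\<open>z \<mapsto> K(z, v)\<close> with \<open>v\<close> the conjugate of \<open>w\<close> is analytic for almost every \<open>w\<close>. This is part of
  what is meant by a kernel of an operator \<open>T\<close> between spaces of analytic functions, where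
  \<open>K(\<cdot>, v)\<close> is the image of a reproducing kernel under \<open>T\<close>; without it the integral operator
  would not map into analytic functions.\<close>

definition analytic_kernel :: "((complex ^ 'd) \<times> (complex ^ 'd) \<Rightarrow> complex) \<Rightarrow> bool" where
  "analytic_kernel K \<longleftrightarrow> (AE w in lborel. analytic_Cd (\<lambda>z. K (z, vcnj w)))"

end

theory Submission
  imports Defs "HOL-Complex_Analysis.Cauchy_Integral_Formula"
begin

text \<open>
  Write \<open>G w = exp (- \<pi> |w|\<^sup>2 / 2)\<close> for the Gaussian weight, so that the norm of \<open>F\<close> in the Fock
  space is the \<open>L\<^sup>p\<close> norm of \<open>f = F G\<close>. The Gaussian in the integral operator is \<open>G\<^sup>2\<close>: one factor
  turns \<open>F\<close> into \<open>f\<close>, the other turns the kernel into \<open>g (z, w) = K (z, w) G w\<close>, with \<open>w\<close> standing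
  for its conjugate in the second argument of \<open>K\<close>. The hypothesis becomes
  \<open>|g (z, w)| G z \<le> |H (z - w)|\<close> almost everywhere. The weighted image of \<open>F\<close> is therefore dominated
  almost everywhere by the convolution of \<open>|f|\<close> with \<open>|H|\<close>, and Young's inequality
  (\<open>convolution_Lp\<close>) bounds its \<open>L\<^sup>p\<close> norm by a constant times that of \<open>f\<close>; for \<open>p = \<infinity>\<close> this is
  immediate.

  It remains to see that the integral converges at every point \<open>z\<close> and is analytic there, although
  the kernel is only controlled almost everywhere. For almost every \<open>w\<close> the kernel is analytic in \<open>z\<close>,
  so its value at a point is at most its average over a ball (\<open>analytic_Cd_sub_mean_value\<close>), which
  sees only values almost everywhere. For \<open>z\<close> near \<open>z\<^sub>0\<close> this gives
  \<open>|g (z, w)| \<le> C \<integral> |H (z' - w)| dz'\<close>, the integral being over a ball about \<open>z\<^sub>0\<close>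
  (\<open>g_locally_bounded\<close>). The right-hand side is a function of \<open>w\<close> that is bounded and integrable,
  so its product with any \<open>f\<close> in \<open>L\<^sup>p\<close> is integrable. Locally uniform domination by an integrable
  function makes an integral of analytic functions analytic (\<open>analytic_Cd_integral\<close>), because the
  Cauchy estimates control derivatives and Taylor remainders by the same dominating function.
\<close>

section \<open>Restriction to complex lines\<close>

lemma bounded_linear_smult_left: "bounded_linear (\<lambda>c. c *s (v :: complex ^ 'd))"
  by (intro linear_conv_bounded_linear[THEN iffD1] linearI)
     (simp_all add: vec_eq_iff vector_scalar_mult_def algebra_simps)

lemma norm_smult: "norm (c *s (v :: complex ^ 'd)) = norm c * norm v"
  by (simp add: norm_vec_def vector_scalar_mult_def norm_mult L2_set_right_distrib)

lemma of_real_smult: "complex_of_real r *s (v :: complex ^ 'd) = r *\<^sub>R v"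
  by (simp add: vec_eq_iff vector_scalar_mult_def of_real_def)

text \<open>
  Facts about one complex variable reach \<open>\<complex>\<^sup>d\<close> through the entire functions
  \<open>c \<mapsto> F (z + c v)\<close>, one for each point and each direction.
\<close>
lemma has_field_derivative_along_line:
  fixes F :: "complex ^ 'd \<Rightarrow> complex"
  assumes "(F has_derivative D) (at (z + c *s v))" and lin: "\<And>c v. D (c *s v) = c * D v"
  shows "((\<lambda>c. F (z + c *s v)) has_field_derivative D v) (at c)"
proof -
  have "((\<lambda>c. z + c *s v) has_derivative (\<lambda>h. h *s v)) (at c)"
    using has_derivative_add[OF has_derivative_const bounded_linear_imp_has_derivative[OF bounded_linear_smult_left]]
    by simp
  from has_derivative_compose[OF this assms(1)]
  show ?thesis by (simp add: has_field_derivative_def lin mult.commute[of _ "D v"])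
qed

lemma analytic_Cd_holomorphic_line:
  assumes "analytic_Cd F"
  shows "(\<lambda>c. F (z + c *s v)) holomorphic_on A"
  unfolding holomorphic_on_def
proof
  fix c
  obtain D where "(F has_derivative D) (at (z + c *s v))" "\<And>c v. D (c *s v) = c * D v"
    using assms unfolding analytic_Cd_def by blast
  from has_field_derivative_along_line[OF this]
  show "(\<lambda>c. F (z + c *s v)) field_differentiable at c within A"
    by (meson field_differentiable_def field_differentiable_at_within)
qed

lemma analytic_Cd_continuous: "analytic_Cd F \<Longrightarrow> continuous_on A F"
  unfolding analytic_Cd_def
  by (meson continuous_at_imp_continuous_on has_derivative_continuous)

lemma analytic_Cd_measurable [measurable_dest]: "analytic_Cd F \<Longrightarrow> F \<in> borel_measurable borel"
  by (simp add: analytic_Cd_continuous borel_measurable_continuous_onI)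

lemma analytic_Cd_cmult: "analytic_Cd F \<Longrightarrow> analytic_Cd (\<lambda>z. a * F z)"
  unfolding analytic_Cd_def
proof
  fix z assume "\<forall>z. \<exists>D. (F has_derivative D) (at z) \<and> (\<forall>c v. D (c *s v) = c * D v)"
  then obtain D where "(F has_derivative D) (at z)" "\<And>c v. D (c *s v) = c * D v" by blast
  then show "\<exists>D. ((\<lambda>z. a * F z) has_derivative D) (at z) \<and> (\<forall>c v. D (c *s v) = c * D v)"
    by (intro exI[of _ "\<lambda>v. a * D v"]) (auto intro: has_derivative_mult_right)
qed

section \<open>The sub-mean value property on balls\<close>

lemma circle_sub_mean_value:
  fixes g :: "complex \<Rightarrow> complex"
  assumes "g holomorphic_on UNIV"
  shows "ennreal (2 * pi) * ennreal (norm (g 0))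
           \<le> (\<integral>\<^sup>+ t. ennreal (norm (g (cis t))) * indicator {0..2*pi} t \<partial>lborel)"
proof -
  have cont: "continuous_on A (\<lambda>t. g (cis t))" for A
    by (rule continuous_on_compose2[OF holomorphic_on_imp_continuous_on[OF assms]])
       (auto intro!: continuous_intros simp: cis_conv_exp)
  have "((\<lambda>u. g u / (u - 0)) has_contour_integral (2 * of_real pi * \<i> * g 0)) (circlepath 0 1)"
    by (rule Cauchy_integral_circlepath_simple) (auto intro: holomorphic_on_subset[OF assms])
  then have *: "((\<lambda>t. g (cis t) * \<i>) has_integral (2 * of_real pi * \<i> * g 0)) {0..2*pi}"
    unfolding circlepath_def by (subst (asm) has_contour_integral_part_circlepath_iff) (auto simp: field_simps)
  have nI: "((\<lambda>t. norm (g (cis t))) has_integral integral {0..2*pi} (\<lambda>t. norm (g (cis t)))) {0..2*pi}"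
    by (intro integrable_integral integrable_continuous_real continuous_on_norm cont)
  have "norm (integral {0..2*pi} (\<lambda>t. g (cis t) * \<i>)) \<le> integral {0..2*pi} (\<lambda>t. norm (g (cis t)))"
    using * nI by (intro integral_norm_bound_integral) (auto simp: norm_mult dest: has_integral_integrable)
  then have "norm (2 * of_real pi * \<i> * g 0) \<le> integral {0..2*pi} (\<lambda>t. norm (g (cis t)))"
    by (simp only: integral_unique[OF *])
  moreover have "(\<integral>\<^sup>+ t. ennreal (norm (g (cis t))) * indicator {0..2*pi} t \<partial>lborel)
     = ennreal (integral {0..2*pi} (\<lambda>t. norm (g (cis t))))"
    by (rule nn_integral_has_integral_lebesgue'[OF _ nI]) auto
  ultimately show ?thesis by (simp add: norm_mult ennreal_mult'[symmetric] ennreal_leI)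
qed

lemma emeasure_lborel_ball_pos:
  assumes "0 < r"
  shows "0 < emeasure lborel (ball (c :: 'a::euclidean_space) r)"
  using assms emeasure_lborel_ball_finite[of c r]
  by (subst emeasure_eq_ennreal_measure) (auto simp: content_ball_pos)

text \<open>
  The image \<open>\<mu>\<close> of Lebesgue measure under an orthogonal map is again invariant under translations
  and gives every centred ball its Lebesgue measure. The usual uniqueness argument for invariant
  measures then applies: for a Borel set \<open>A\<close> and the unit ball \<open>B\<close>, Tonelli's theorem and two
  translations turn \<open>\<mu>(A) |B|\<close> into \<open>|A| \<mu>(B)\<close>, and \<open>\<mu>(B) = |B|\<close> is positive and finite.
\<close>
lemma lborel_distr_orthogonal:
  fixes T :: "'a::euclidean_space \<Rightarrow> 'a"
  assumes T: "orthogonal_transformation T"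
  shows "distr lborel borel T = lborel"
proof -
  define \<mu> where "\<mu> = distr lborel borel T"
  have lin: "linear T" using T by (simp add: orthogonal_transformation_def)
  have [measurable]: "T \<in> borel_measurable borel"
    using lin by (simp add: borel_measurable_continuous_onI linear_continuous_on linear_conv_bounded_linear)
  have sets_\<mu> [measurable_cong, simp]: "sets \<mu> = sets borel" by (simp add: \<mu>_def)
  have ball: "emeasure \<mu> (ball 0 r) = emeasure lborel (ball (0::'a) r)" for r
  proof -
    have "T -` ball 0 r = ball 0 r" using T by (auto simp: orthogonal_transformation_norm)
    then show ?thesis by (simp add: \<mu>_def emeasure_distr)
  qed
  interpret M: sigma_finite_measure \<mu>
  proof (standard, intro exI conjI)
    show "countable (range (\<lambda>n::nat. ball (0::'a) (real n)))" by simp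
    show "range (\<lambda>n::nat. ball (0::'a) (real n)) \<subseteq> sets \<mu>" by auto
    show "\<Union> (range (\<lambda>n::nat. ball (0::'a) (real n))) = space \<mu>"
      by (auto simp: \<mu>_def) (metis reals_Archimedean2)
    show "\<forall>a\<in>range (\<lambda>n::nat. ball (0::'a) (real n)). emeasure \<mu> a \<noteq> \<infinity>"
      using emeasure_lborel_ball_finite by (auto simp: ball less_top)
  qed
  interpret P: pair_sigma_finite \<mu> "lborel :: 'a measure" ..
  \<comment> \<open>A translation of the image is the image of a translation, because an orthogonal map is onto.\<close>
  have inv_\<mu>: "(\<integral>\<^sup>+x. f x \<partial>\<mu>) = (\<integral>\<^sup>+x. f (x + y) \<partial>\<mu>)"
    if [measurable]: "f \<in> borel_measurable borel" for f :: "'a \<Rightarrow> ennreal" and y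
  proof -
    obtain a where a: "T a = y" using orthogonal_transformation_surj[OF T] by (metis surjD)
    have "(\<integral>\<^sup>+x. f x \<partial>\<mu>) = (\<integral>\<^sup>+x. f (T x) \<partial>lborel)" by (simp add: \<mu>_def nn_integral_distr)
    also have "\<dots> = (\<integral>\<^sup>+x. f (T (a + x)) \<partial>lborel)"
      by (subst lborel_distr_plus[of a, symmetric]) (simp add: nn_integral_distr)
    also have "\<dots> = (\<integral>\<^sup>+x. f (x + y) \<partial>\<mu>)"
      by (simp add: \<mu>_def nn_integral_distr linear_add[OF lin] a add.commute)
    finally show ?thesis .
  qed
  have inv_l: "(\<integral>\<^sup>+x. f x \<partial>lborel) = (\<integral>\<^sup>+x. f (y + x) \<partial>lborel)"
    if [measurable]: "f \<in> borel_measurable borel" for f :: "'a \<Rightarrow> ennreal" and y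
    by (subst lborel_distr_plus[of y, symmetric]) (simp add: nn_integral_distr)
  let ?B = "ball (0::'a) 1"
  have [measurable]: "?B \<in> sets borel" by simp
  have "\<mu> = lborel"
  proof (rule measure_eqI)
    fix A assume "A \<in> sets \<mu>"
    then have [measurable]: "A \<in> sets borel" by simp
    have "emeasure \<mu> A * emeasure lborel ?B = (\<integral>\<^sup>+x. \<integral>\<^sup>+y. indicator A x * indicator ?B y \<partial>lborel \<partial>\<mu>)"
      by (subst nn_integral_cmult) (simp_all add: nn_integral_multc)
    also have "\<dots> = (\<integral>\<^sup>+x. \<integral>\<^sup>+y. indicator A x * indicator ?B (- x + y) \<partial>lborel \<partial>\<mu>)"
      by (intro nn_integral_cong inv_l) measurable
    also have "\<dots> = (\<integral>\<^sup>+y. \<integral>\<^sup>+x. indicator A x * indicator ?B (- x + y) \<partial>\<mu> \<partial>lborel)"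
      by (rule P.Fubini'[symmetric]) measurable
    also have "\<dots> = (\<integral>\<^sup>+y. \<integral>\<^sup>+x. indicator A (x + y) * indicator ?B (- (x + y) + y) \<partial>\<mu> \<partial>lborel)"
      by (intro nn_integral_cong inv_\<mu>) measurable
    \<comment> \<open>The argument of the ball's indicator is now \<open>- x\<close>, and the ball is symmetric.\<close>
    also have "\<dots> = (\<integral>\<^sup>+y. \<integral>\<^sup>+x. indicator A (x + y) * indicator ?B x \<partial>\<mu> \<partial>lborel)"
      by (simp add: indicator_def)
    also have "\<dots> = (\<integral>\<^sup>+x. \<integral>\<^sup>+y. indicator A (x + y) * indicator ?B x \<partial>lborel \<partial>\<mu>)"
      by (rule P.Fubini') measurable
    also have "\<dots> = (\<integral>\<^sup>+x. \<integral>\<^sup>+y. indicator A y * indicator ?B x \<partial>lborel \<partial>\<mu>)"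
      by (intro nn_integral_cong inv_l[symmetric]) measurable
    also have "\<dots> = emeasure lborel A * emeasure lborel ?B"
      by (subst nn_integral_multc) (simp_all add: nn_integral_cmult ball)
    finally have "emeasure lborel ?B * emeasure \<mu> A = emeasure lborel ?B * emeasure lborel A"
      by (simp add: mult.commute)
    then show "emeasure \<mu> A = emeasure lborel A"
      using emeasure_lborel_ball_pos[of 1 "0::'a"] emeasure_lborel_ball_finite[of "0::'a" 1]
      by (auto simp: ennreal_mult_cancel_left)
  qed simp
  then show ?thesis by (simp add: \<mu>_def)
qed

lemma orthogonal_transformation_smult:
  assumes "norm c = 1"
  shows "orthogonal_transformation (\<lambda>v. c *s (v :: complex ^ 'd))"
  unfolding orthogonal_transformation
proof
  show "linear (\<lambda>v. c *s (v :: complex ^ 'd))"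
    by (rule linearI) (simp_all add: vec_eq_iff vector_scalar_mult_def algebra_simps)
qed (simp add: norm_smult assms)

text \<open>
  On each circle \<open>z + e\<^sup>i\<^sup>t v\<close> the one-variable mean value inequality bounds \<open>|F z|\<close>. Averaging this
  over \<open>v\<close> in a centred ball and exchanging the integrals, the rotation \<open>v \<mapsto> e\<^sup>i\<^sup>t v\<close> preserves both
  the ball and Lebesgue measure, so the average over \<open>t\<close> disappears and a volume average remains.
  The bound is what turns almost everywhere information about an analytic function into information
  at every point.
\<close>
lemma analytic_Cd_sub_mean_value:
  fixes F :: "complex ^ 'd \<Rightarrow> complex"
  assumes F: "analytic_Cd F"
  shows "emeasure lborel (ball (0 :: complex ^ 'd) r) * ennreal (norm (F z))
           \<le> (\<integral>\<^sup>+ z'. ennreal (norm (F z')) * indicator (ball z r) z' \<partial>lborel)"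
proof -
  let ?B = "ball 0 r :: (complex ^ 'd) set"
  let ?I = "\<integral>\<^sup>+ v. ennreal (norm (F (z + v))) * indicator ?B v \<partial>lborel"
  have [measurable]: "F \<in> borel_measurable borel" using F by (rule analytic_Cd_measurable)
  have [measurable]: "?B \<in> sets borel" by simp
  have cont: "continuous_on UNIV (\<lambda>(v :: complex ^ 'd, t). cis t *s v)"
    unfolding vector_scalar_mult_def case_prod_beta
    by (intro continuous_intros continuous_on_vec_lambda)
  have [measurable]: "(\<lambda>(v :: complex ^ 'd, t). cis t *s v) \<in> borel_measurable (borel \<Otimes>\<^sub>M borel)"
    unfolding borel_prod by (rule borel_measurable_continuous_onI[OF cont])
  have [measurable]: "(\<lambda>v. c *s v) \<in> borel_measurable (borel :: (complex ^ 'd) measure)" for c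
    by (intro borel_measurable_continuous_onI linear_continuous_on linear_conv_bounded_linear[THEN iffD1])
      (rule linearI; simp add: vec_eq_iff vector_scalar_mult_def algebra_simps)
  have "ennreal (2 * pi) * (emeasure lborel ?B * ennreal (norm (F z)))
      = (\<integral>\<^sup>+ v. ennreal (2 * pi) * ennreal (norm (F z)) * indicator ?B v \<partial>lborel)"
    by (subst nn_integral_cmult_indicator) (simp_all add: mult_ac)
  also have "\<dots> \<le> (\<integral>\<^sup>+ v. (\<integral>\<^sup>+ t. ennreal (norm (F (z + cis t *s v))) * indicator {0..2*pi} t \<partial>lborel)
      * indicator ?B v \<partial>lborel)"
  proof (intro nn_integral_mono mult_right_mono)
    fix v
    show "ennreal (2 * pi) * ennreal (norm (F z))
        \<le> (\<integral>\<^sup>+ t. ennreal (norm (F (z + cis t *s v))) * indicator {0..2*pi} t \<partial>lborel)"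
      using circle_sub_mean_value[OF analytic_Cd_holomorphic_line[OF F, of z v]] by simp
  qed simp
  also have "\<dots> = (\<integral>\<^sup>+ v. \<integral>\<^sup>+ t. ennreal (norm (F (z + cis t *s v))) * indicator {0..2*pi} t
      * indicator ?B v \<partial>lborel \<partial>lborel)"
    by (intro nn_integral_cong nn_integral_multc[symmetric]) measurable
  also have "\<dots> = (\<integral>\<^sup>+ t. \<integral>\<^sup>+ v. ennreal (norm (F (z + cis t *s v))) * indicator {0..2*pi} t
      * indicator ?B v \<partial>lborel \<partial>lborel)"
    by (rule lborel_pair.Fubini'[symmetric]) measurable
  also have "\<dots> = (\<integral>\<^sup>+ t. ?I * indicator {0..2*pi} t \<partial>lborel)"
  proof (rule nn_integral_cong)
    fix t :: real
    have "?I = (\<integral>\<^sup>+ v. ennreal (norm (F (z + cis t *s v))) * indicator ?B (cis t *s v) \<partial>lborel)"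
      by (subst lborel_distr_orthogonal[OF orthogonal_transformation_smult[of "cis t"], symmetric])
         (simp_all add: nn_integral_distr)
    also have "\<dots> = (\<integral>\<^sup>+ v. ennreal (norm (F (z + cis t *s v))) * indicator ?B v \<partial>lborel)"
      by (simp add: indicator_def norm_smult)
    finally show "(\<integral>\<^sup>+ v. ennreal (norm (F (z + cis t *s v))) * indicator {0..2*pi} t
      * indicator ?B v \<partial>lborel) = ?I * indicator {0..2*pi} t"
      by (cases "t \<in> {0..2*pi}") simp_all
  qed
  also have "\<dots> = ennreal (2 * pi) * ?I"
    by (subst nn_integral_cmult_indicator) (simp_all add: mult.commute)
  finally have "emeasure lborel ?B * ennreal (norm (F z)) \<le> ?I"
    by (subst (asm) ennreal_mult_le_mult_iff) auto
  also have "?I = (\<integral>\<^sup>+ z'. ennreal (norm (F z')) * indicator (ball z r) z' \<partial>lborel)"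
    by (subst (2) lborel_distr_plus[of z, symmetric])
       (simp add: nn_integral_distr indicator_def dist_norm)
  finally show ?thesis .
qed

section \<open>Cauchy estimates and holomorphic parameter integrals\<close>

lemma entire_Taylor_bound:
  fixes g :: "complex \<Rightarrow> complex"
  assumes hol: "g holomorphic_on UNIV"
    and M: "\<And>c. norm c \<le> 2 \<Longrightarrow> norm (g c) \<le> M" and c: "norm c \<le> 1"
  shows "norm (g c - g 0 - deriv g 0 * c) \<le> 2 * M * (norm c)\<^sup>2"
    and "norm (deriv g 0) \<le> M"
proof -
  \<comment> \<open>The unit circle about a point of the unit disc stays in the disc of radius 2.\<close>
  have bd: "norm ((deriv ^^ n) g x) \<le> fact n * M" if "norm x \<le> 1" for x n
  proof -
    have "norm (g y) \<le> M" if "norm (x - y) = 1" for y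
      using norm_triangle_ineq4[of x "x - y"] \<open>norm x \<le> 1\<close> that by (intro M) simp
    then show ?thesis
      using Cauchy_inequality[of g x 1 M n] holomorphic_on_subset[OF hol] holomorphic_on_imp_continuous_on
      by (metis div_by_1 power_one subset_UNIV zero_less_one)
  qed
  have "norm ((deriv ^^ 0) g c - (\<Sum>i\<le>1. (deriv ^^ i) g 0 * (c - 0) ^ i / fact i))
      \<le> (fact 2 * M) * norm (c - 0) ^ Suc 1 / fact 1"
  proof (rule complex_Taylor[of "cball 0 1"])
    fix i :: nat and x :: complex
    have "(deriv ^^ i) g holomorphic_on UNIV" by (intro holomorphic_higher_deriv hol) auto
    then show "((deriv ^^ i) g has_field_derivative (deriv ^^ Suc i) g x) (at x within cball 0 1)"
      by (simp add: holomorphic_derivI has_field_derivative_at_within)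
  next
    fix x :: complex assume "x \<in> cball 0 1"
    then show "norm ((deriv ^^ Suc 1) g x) \<le> fact 2 * M"
      using bd[of x 2] by (simp add: numeral_2_eq_2)
  qed (use c in auto)
  then show "norm (g c - g 0 - deriv g 0 * c) \<le> 2 * M * (norm c)\<^sup>2"
    by (simp add: power2_eq_square algebra_simps)
  show "norm (deriv g 0) \<le> M" using bd[of 0 1] by simp
qed

text \<open>
  The remainder of the first-order expansion is bounded in terms of \<open>M\<close> alone. This uniformity is
  what allows an integral over a parameter to be taken termwise.
\<close>
lemma analytic_Cd_Taylor_bound:
  fixes F :: "complex ^ 'd \<Rightarrow> complex"
  assumes F: "analytic_Cd F" and D: "(F has_derivative D) (at z)" "\<And>c v. D (c *s v) = c * D v"
    and M: "\<And>z'. z' \<in> cball z 2 \<Longrightarrow> norm (F z') \<le> M"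
  shows "norm (D v) \<le> M * norm v"
    and "norm v \<le> 1 \<Longrightarrow> norm (F (z + v) - F z - D v) \<le> 2 * M * (norm v)\<^sup>2"
proof -
  define u where "u = (1 / norm v) *\<^sub>R v"
  have u: "norm u \<le> 1" and v: "v = of_real (norm v) *s u"
    by (auto simp: u_def of_real_smult)
  define g where "g = (\<lambda>c. F (z + c *s u))"
  have hol: "g holomorphic_on UNIV" unfolding g_def by (rule analytic_Cd_holomorphic_line[OF F])
  have M': "norm (g c) \<le> M" if "norm c \<le> 2" for c
    unfolding g_def using that u mult_mono[of "norm c" 2 "norm u" 1]
    by (intro M) (simp add: dist_norm norm_smult)
  have "(g has_field_derivative D u) (at 0)"
    unfolding g_def using D by (intro has_field_derivative_along_line) simp_all
  then have Du: "deriv g 0 = D u" by (rule DERIV_imp_deriv)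
  have Dv: "D v = of_real (norm v) * D u" by (subst v) (rule D(2))
  have "norm (D u) \<le> M" using entire_Taylor_bound(2)[OF hol M', of 0] Du by simp
  then show "norm (D v) \<le> M * norm v"
    by (simp add: Dv norm_mult mult.commute[of M] mult_left_mono)
  assume "norm v \<le> 1"
  then have "norm (g (of_real (norm v)) - g 0 - deriv g 0 * of_real (norm v)) \<le> 2 * M * (norm v)\<^sup>2"
    using entire_Taylor_bound(1)[OF hol M', of "of_real (norm v)"] by simp
  moreover have "g (of_real (norm v)) = F (z + v)" "g 0 = F z"
    using v by (simp_all add: g_def)
  ultimately show "norm (F (z + v) - F z - D v) \<le> 2 * M * (norm v)\<^sup>2"
    by (simp add: Du Dv mult.commute)
qed


text \<open>
  By the Cauchy estimates a local dominating function \<open>g\<close> for \<open>f\<close> also dominates the derivatives of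
  \<open>f\<close>, and \<open>2 |v|\<^sup>2 g\<close> dominates the first-order remainder. Integrating over the parameter shows
  that the integral has the integral of the derivatives as its derivative.
\<close>
lemma analytic_Cd_integral:
  fixes f :: "complex ^ 'd \<Rightarrow> 'b \<Rightarrow> complex"
  assumes meas [measurable]: "\<And>z. f z \<in> borel_measurable M"
    and an: "AE w in M. analytic_Cd (\<lambda>z. f z w)"
    and dom: "\<And>z. \<exists>g. integrable M g \<and> (AE w in M. \<forall>z'\<in>cball z 2. norm (f z' w) \<le> g w)"
  shows "analytic_Cd (\<lambda>z. \<integral>w. f z w \<partial>M)"
  unfolding analytic_Cd_def
proof
  fix z
  obtain g where g: "integrable M g" and bd: "AE w in M. \<forall>z'\<in>cball z 2. norm (f z' w) \<le> g w"
    using dom by blast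
  have int: "integrable M (f z')" if "z' \<in> cball z 2" for z'
    by (rule Bochner_Integration.integrable_bound[OF g meas])
       (use bd that in \<open>auto elim!: eventually_mono intro: order_trans[OF _ abs_ge_self]\<close>)
  define h :: "nat \<Rightarrow> complex" where "h n = inverse (of_nat (Suc n))" for n
  \<comment> \<open>The derivative in \<open>z\<close> may fail to exist on a null set of parameters, so it is replaced by a
    limit of difference quotients, which is measurable in \<open>w\<close> without exception.\<close>
  define d where "d v w = lim (\<lambda>n. (f (z + h n *s v) w - f z w) / h n)" for v w
  have [measurable]: "d v \<in> borel_measurable M" for v unfolding d_def by measurable
  have deriv: "AE w in M. \<exists>D. ((\<lambda>z. f z w) has_derivative D) (at z) \<and> (\<forall>c v. D (c *s v) = c * D v) \<and>
      (\<forall>v. d v w = D v)"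
    using an
  proof eventually_elim
    case (elim w)
    then obtain D where D: "((\<lambda>z. f z w) has_derivative D) (at z)" "\<And>c v. D (c *s v) = c * D v"
      unfolding analytic_Cd_def by blast
    have "d v w = D v" for v
      unfolding d_def
    proof (rule limI)
      have "((\<lambda>c. f (z + c *s v) w) has_field_derivative D v) (at 0)"
        using D by (intro has_field_derivative_along_line) simp_all
      then have "((\<lambda>c. (f (z + c *s v) w - f z w) / c) \<longlongrightarrow> D v) (at 0)"
        by (simp add: DERIV_def)
      moreover have "h \<longlonglongrightarrow> 0" unfolding h_def by (rule LIMSEQ_Suc[OF lim_inverse_n])
      then have "filterlim h (at 0) sequentially"
        by (rule filterlim_atI) (simp add: h_def del: of_nat_Suc)
      ultimately show "(\<lambda>n. (f (z + h n *s v) w - f z w) / h n) \<longlonglongrightarrow> D v"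
        by (rule filterlim_compose)
    qed
    with D show ?case by blast
  qed
  have d_bound: "AE w in M. norm (d v w) \<le> g w * norm v" for v
    using deriv an bd
  proof eventually_elim
    case (elim w)
    then obtain D where D: "((\<lambda>z. f z w) has_derivative D) (at z)" "\<And>c v. D (c *s v) = c * D v"
      "\<And>v. d v w = D v" by blast
    show ?case
      unfolding D(3) by (rule analytic_Cd_Taylor_bound(1)[OF _ D(1,2)]) (use elim in auto)
  qed
  have d_Taylor: "AE w in M. norm (f (z + v) w - f z w - d v w) \<le> 2 * g w * (norm v)\<^sup>2" if "norm v \<le> 1" for v
    using deriv an bd
  proof eventually_elim
    case (elim w)
    then obtain D where D: "((\<lambda>z. f z w) has_derivative D) (at z)" "\<And>c v. D (c *s v) = c * D v"
      "\<And>v. d v w = D v" by blast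
    show ?case
      unfolding D(3) by (rule analytic_Cd_Taylor_bound(2)[OF _ D(1,2)]) (use elim that in auto)
  qed
  have d_int: "integrable M (d v)" for v
    by (rule Bochner_Integration.integrable_bound[of M "\<lambda>w. g w * norm v"])
       (use g d_bound[of v] in \<open>auto elim!: eventually_mono\<close>)
  define D where "D v = (\<integral>w. d v w \<partial>M)" for v
  have smult: "D (c *s v) = c * D v" for c v
  proof -
    have "D (c *s v) = (\<integral>w. c * d v w \<partial>M)"
      unfolding D_def by (rule integral_cong_AE) (use deriv in \<open>auto elim!: eventually_mono\<close>)
    then show ?thesis by (simp add: D_def)
  qed
  have add: "D (v + v') = D v + D v'" for v v'
  proof -
    have "D (v + v') = (\<integral>w. d v w + d v' w \<partial>M)"
      unfolding D_def
      by (rule integral_cong_AE)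
         (use deriv in \<open>auto elim!: eventually_mono simp: linear_add[OF has_derivative_linear]\<close>)
    then show ?thesis by (simp add: D_def d_int)
  qed
  have "linear D"
    by (rule linearI) (simp_all add: add of_real_smult[symmetric] smult scaleR_conv_of_real)
  then have "bounded_linear D" by (simp add: linear_conv_bounded_linear)
  moreover have "((\<lambda>v. norm ((\<integral>w. f (z + v) w \<partial>M) - (\<integral>w. f z w \<partial>M) - D v) / norm v) \<longlongrightarrow> 0) (at 0)"
  proof (rule tendsto_sandwich[OF _ _ tendsto_const])
    have bound: "norm ((\<integral>w. f (z + v) w \<partial>M) - (\<integral>w. f z w \<partial>M) - D v) \<le> (2 * (\<integral>w. g w \<partial>M) * (norm v)\<^sup>2)"
      if "norm v \<le> 1" for v
    proof -
      have i: "integrable M (f (z + v))" "integrable M (f z)" using that by (auto intro!: int simp: dist_norm)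
      have "norm (\<integral>w. f (z + v) w - f z w - d v w \<partial>M) \<le> (\<integral>w. 2 * g w * (norm v)\<^sup>2 \<partial>M)"
        by (rule order_trans[OF integral_norm_bound integral_mono_AE]) (use i d_int g d_Taylor[OF that] in auto)
      then show ?thesis using i d_int by (simp add: D_def)
    qed
    have "eventually (\<lambda>v. norm v < 1) (at (0 :: complex ^ 'd))"
      by (intro eventually_at_ball'[of 1 0 UNIV, THEN eventually_mono]) auto
    then show "\<forall>\<^sub>F v in at 0. norm ((\<integral>w. f (z + v) w \<partial>M) - (\<integral>w. f z w \<partial>M) - D v) / norm v
        \<le> 2 * (\<integral>w. g w \<partial>M) * norm v"
      using eventually_neq_at_within[of 0 0 UNIV]
      by eventually_elim (use bound in \<open>auto simp: divide_le_eq power2_eq_square mult_ac\<close>)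
    show "((\<lambda>v. 2 * (\<integral>w. g w \<partial>M) * norm v) \<longlongrightarrow> 0) (at (0 :: complex ^ 'd))"
      by (auto intro!: tendsto_eq_intros)
  qed auto
  ultimately show "\<exists>D. ((\<lambda>z. \<integral>w. f z w \<partial>M) has_derivative D) (at z) \<and> (\<forall>c v. D (c *s v) = c * D v)"
    using smult unfolding has_derivative_at by blast
qed

section \<open>Jensen's inequality for powers and invariance of Lebesgue measure\<close>

lemma powr_above_tangent:
  fixes r t m :: real
  assumes "1 \<le> r" "0 \<le> t" "0 < m"
  shows "m powr r + r * m powr (r - 1) * (t - m) \<le> t powr r"
proof (cases "t = 0")
  case True
  have "m powr (r - 1) * m = m powr r"
    using assms by (simp add: powr_mult_base mult.commute)
  then have "m powr r + r * m powr (r - 1) * (0 - m) = (1 - r) * m powr r"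
    by (simp add: algebra_simps)
  also have "\<dots> \<le> 0" using assms by (simp add: mult_nonpos_nonneg)
  finally show ?thesis using True by simp
next
  case False
  have "((\<lambda>x. x powr r) has_real_derivative r * m powr (r - 1)) (at m within {0<..})"
    using assms by (auto intro!: derivative_eq_intros)
  then have "r * m powr (r - 1) * (t - m) \<le> t powr r - m powr r"
    using assms False powr_convex[of r]
    by (intro convex_on_imp_above_tangent[of "{0<..}"]) (auto simp: interior_open)
  then show ?thesis by simp
qed

lemma le_one_plus_powr:
  fixes t r :: real
  assumes "1 \<le> r" "0 \<le> t"
  shows "t \<le> 1 + t powr r"
proof (cases "t \<le> 1")
  case False
  then have "t powr 1 \<le> t powr r" using assms by (intro powr_mono) auto
  then show ?thesis using False by simp
qed (use assms in \<open>simp add: add_increasing2\<close>)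

text \<open>
  Jensen's inequality for the convex function \<open>t\<^sup>r\<close> and the measure with density \<open>\<psi>\<close>: the tangent
  of \<open>t\<^sup>r\<close> at the weighted mean \<open>m\<close> is integrated against \<open>\<psi>\<close>. The normalising constant \<open>A\<close> is only
  an upper bound for the total mass, which is enough since \<open>r \<ge> 1\<close> and which keeps the division by
  \<open>A\<close> meaningful when \<open>\<psi>\<close> vanishes almost everywhere.
\<close>
lemma Jensen_powr_integral:
  fixes f \<psi> :: "'a \<Rightarrow> real"
  assumes r: "1 \<le> r" and A: "0 < A" "(\<integral>x. \<psi> x \<partial>M) \<le> A"
    and nonneg: "\<And>x. 0 \<le> f x" "\<And>x. 0 \<le> \<psi> x"
    and [measurable]: "f \<in> borel_measurable M" and \<psi>: "integrable M \<psi>"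
    and fr: "integrable M (\<lambda>x. f x powr r * \<psi> x)"
  shows "integrable M (\<lambda>x. f x * \<psi> x)"
    and "(\<integral>x. f x * \<psi> x \<partial>M) powr r \<le> A powr (r - 1) * (\<integral>x. f x powr r * \<psi> x \<partial>M)"
proof -
  have [measurable]: "\<psi> \<in> borel_measurable M" using \<psi> by simp
  show int: "integrable M (\<lambda>x. f x * \<psi> x)"
  proof (rule Bochner_Integration.integrable_bound)
    show "integrable M (\<lambda>x. \<psi> x + f x powr r * \<psi> x)" using \<psi> fr by simp
    show "AE x in M. norm (f x * \<psi> x) \<le> norm (\<psi> x + f x powr r * \<psi> x)"
    proof (rule AE_I2)
      fix x
      have "f x * \<psi> x \<le> (1 + f x powr r) * \<psi> x"
        by (intro mult_right_mono le_one_plus_powr r nonneg)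
      then show "norm (f x * \<psi> x) \<le> norm (\<psi> x + f x powr r * \<psi> x)"
        by (simp add: nonneg algebra_simps)
    qed
  qed measurable
  define m where "m = (\<integral>x. f x * \<psi> x \<partial>M) / A"
  have I: "(\<integral>x. f x * \<psi> x \<partial>M) = A * m" using A by (simp add: m_def)
  have "0 \<le> m" using A by (auto simp: m_def intro!: divide_nonneg_pos Bochner_Integration.integral_nonneg mult_nonneg_nonneg nonneg)
  show "(\<integral>x. f x * \<psi> x \<partial>M) powr r \<le> A powr (r - 1) * (\<integral>x. f x powr r * \<psi> x \<partial>M)"
  proof (cases "m = 0")
    case True
    then show ?thesis
      unfolding I by (auto intro!: mult_nonneg_nonneg Bochner_Integration.integral_nonneg nonneg)
  next
    case False
    with \<open>0 \<le> m\<close> have m: "0 < m" by simp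
    have mm: "m powr (r - 1) * m = m powr r"
      using m by (simp add: powr_mult_base mult.commute)
    have "(\<integral>x. (m powr r - r * m powr r) * \<psi> x + r * m powr (r - 1) * (f x * \<psi> x) \<partial>M)
        \<le> (\<integral>x. f x powr r * \<psi> x \<partial>M)"
    proof (rule integral_mono)
      fix x
      have "(m powr r + r * m powr (r - 1) * (f x - m)) * \<psi> x \<le> f x powr r * \<psi> x"
        by (intro mult_right_mono powr_above_tangent r m nonneg)
      then show "(m powr r - r * m powr r) * \<psi> x + r * m powr (r - 1) * (f x * \<psi> x) \<le> f x powr r * \<psi> x"
        by (simp add: algebra_simps mm[symmetric])
    qed (use \<psi> int fr in auto)
    moreover have "(\<integral>x. (m powr r - r * m powr r) * \<psi> x + r * m powr (r - 1) * (f x * \<psi> x) \<partial>M)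
        = (m powr r - r * m powr r) * (\<integral>x. \<psi> x \<partial>M) + r * m powr (r - 1) * (A * m)"
      using \<psi> int by (subst Bochner_Integration.integral_add) (auto simp: I)
    ultimately have *: "(1 - r) * m powr r * (\<integral>x. \<psi> x \<partial>M) + r * m powr r * A \<le> (\<integral>x. f x powr r * \<psi> x \<partial>M)"
      by (simp add: algebra_simps mm[symmetric])
    have "(1 - r) * m powr r * A \<le> (1 - r) * m powr r * (\<integral>x. \<psi> x \<partial>M)"
      using A r by (intro mult_left_mono_neg) (auto simp: mult_nonpos_nonneg)
    with * have "m powr r * A \<le> (\<integral>x. f x powr r * \<psi> x \<partial>M)"
      by (simp add: algebra_simps)
    then have "A powr (r - 1) * (m powr r * A) \<le> A powr (r - 1) * (\<integral>x. f x powr r * \<psi> x \<partial>M)"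
      by (intro mult_left_mono) auto
    moreover have "A powr (r - 1) * (m powr r * A) = (A * m) powr r"
      using A m by (simp add: powr_mult powr_diff)
    ultimately show ?thesis by (simp add: I)
  qed
qed

lemma nn_integral_lborel_translate:
  fixes h :: "'a::euclidean_space \<Rightarrow> ennreal"
  assumes [measurable]: "h \<in> borel_measurable borel"
  shows "(\<integral>\<^sup>+ z. h (z - w) \<partial>lborel) = (\<integral>\<^sup>+ x. h x \<partial>lborel)"
  by (subst (2) lborel_distr_plus[of "- w", symmetric]) (simp add: nn_integral_distr)

lemma nn_integral_lborel_reflect:
  fixes h :: "'a::euclidean_space \<Rightarrow> ennreal"
  assumes [measurable]: "h \<in> borel_measurable borel"
  shows "(\<integral>\<^sup>+ w. h (z - w) \<partial>lborel) = (\<integral>\<^sup>+ x. h x \<partial>lborel)"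
proof -
  have "orthogonal_transformation (uminus :: 'a \<Rightarrow> 'a)"
    by (simp add: orthogonal_transformation_def linear_uminus)
  then have "(\<integral>\<^sup>+ x. h x \<partial>lborel) = (\<integral>\<^sup>+ x. h x \<partial>distr lborel borel uminus)"
    by (simp add: lborel_distr_orthogonal)
  also have "\<dots> = (\<integral>\<^sup>+ x. h (- x) \<partial>lborel)"
    by (simp add: nn_integral_distr)
  also have "\<dots> = (\<integral>\<^sup>+ w. h (z - w) \<partial>lborel)"
    by (subst lborel_distr_plus[of "- z", symmetric]) (simp add: nn_integral_distr)
  finally show ?thesis by simp
qed

section \<open>Measurability of tempered kernels\<close>

text \<open>
  Local integrability gives measurability of all truncations to balls, and these converge pointwise.
\<close>
lemma tempered_function_measurable:
  fixes f :: "'a::euclidean_space \<Rightarrow> complex"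
  assumes "tempered_function f"
  shows "f \<in> borel_measurable borel"
proof (rule borel_measurable_LIMSEQ_metric)
  fix n :: nat
  have "set_integrable lborel (cball 0 (real n)) f"
    using assms by (simp add: tempered_function_def)
  then show "(\<lambda>x. indicator (cball 0 (real n)) x *\<^sub>R f x) \<in> borel_measurable borel"
    unfolding set_integrable_def using borel_measurable_integrable by fastforce
next
  fix x :: 'a
  obtain N where N: "norm x \<le> real N" using real_arch_simple by blast
  have "\<forall>\<^sub>F n in sequentially. indicator (cball 0 (real n)) x *\<^sub>R f x = f x"
    using eventually_ge_at_top[of N] by eventually_elim (use N in \<open>auto simp: indicator_def\<close>)
  then show "(\<lambda>n. indicator (cball 0 (real n)) x *\<^sub>R f x) \<longlonglongrightarrow> f x"
    by (rule tendsto_eventually)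
qed

lemma tempered_kernel_measurable:
  assumes "tempered_kernel K"
  shows "(\<lambda>(z, w). K (z, vcnj w)) \<in> borel_measurable borel"
  using assms unfolding tempered_kernel_def
proof
  let ?e = "\<lambda>s (z, w). complex_of_real (exp (s * pi * ((norm z)\<^sup>2 + (norm w)\<^sup>2) / 2))"
  assume "tempered_function (\<lambda>(z, w). K (z, vcnj w) * of_real (exp (- pi * ((norm z)\<^sup>2 + (norm w)\<^sup>2) / 2)))"
  from tempered_function_measurable[OF this]
  have "(\<lambda>x. (case x of (z, w) \<Rightarrow> K (z, vcnj w) * of_real (exp (- pi * ((norm z)\<^sup>2 + (norm w)\<^sup>2) / 2))) * ?e 1 x)
      \<in> borel_measurable borel"
    by (rule borel_measurable_times)
      (auto intro!: borel_measurable_continuous_onI continuous_intros simp: case_prod_beta)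
  moreover have "(case x of (z, w) \<Rightarrow> K (z, vcnj w) * of_real (exp (- pi * ((norm z)\<^sup>2 + (norm w)\<^sup>2) / 2))) * ?e 1 x
      = (case x of (z, w) \<Rightarrow> K (z, vcnj w))" for x
    by (simp add: case_prod_beta exp_of_real[symmetric] mult.assoc mult_exp_exp)
  ultimately show ?thesis by simp
qed (rule tempered_function_measurable)

section \<open>Kernels dominated by a convolution kernel\<close>

text \<open>
  Here \<open>g (z, w)\<close> is the integral kernel times the Gaussian weight in \<open>w\<close>, which leaves the weight in
  \<open>z\<close> on the right-hand side of the bound, and \<open>h\<close> is \<open>|H|\<close>.
\<close>
locale convolution_dominated_kernel =
  fixes g :: "(complex ^ 'd) \<times> (complex ^ 'd) \<Rightarrow> complex" and h :: "complex ^ 'd \<Rightarrow> real"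
  assumes g_measurable [measurable]: "g \<in> borel_measurable borel"
    and g_analytic: "AE w in lborel. analytic_Cd (\<lambda>z. g (z, w))"
    and h_nonneg: "0 \<le> h x"
    and h_integrable: "integrable lborel h"
    and g_bound: "AE x in lborel. norm (g x) \<le> exp (pi * (norm (fst x))\<^sup>2 / 2) * h (fst x - snd x)"
begin

lemma h_measurable [measurable]: "h \<in> borel_measurable borel"
  using h_integrable by auto

lemma g_measurable_pair [measurable]: "g \<in> borel_measurable (borel \<Otimes>\<^sub>M borel)"
  by (simp add: borel_prod g_measurable)

abbreviation mass :: real where "mass \<equiv> \<integral>x. h x \<partial>lborel"

lemma mass_nonneg: "0 \<le> mass" by (simp add: h_nonneg)

lemma nn_integral_h: "(\<integral>\<^sup>+ x. ennreal (h x) \<partial>lborel) = ennreal mass"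
  by (intro nn_integral_eq_integral h_integrable) (simp add: h_nonneg)

lemma nn_integral_h_left: "(\<integral>\<^sup>+ z. ennreal (h (z - w)) \<partial>lborel) = ennreal mass"
  using nn_integral_lborel_translate[of "\<lambda>x. ennreal (h x)" w] by (simp add: nn_integral_h)

lemma nn_integral_h_right: "(\<integral>\<^sup>+ w. ennreal (h (z - w)) \<partial>lborel) = ennreal mass"
  using nn_integral_lborel_reflect[of "\<lambda>x. ennreal (h x)" z] by (simp add: nn_integral_h)

lemma g_bound_right:
  "AE z in lborel. AE w in lborel. norm (g (z, w)) \<le> exp (pi * (norm z)\<^sup>2 / 2) * h (z - w)"
  using lborel_pair.AE_pair[OF g_bound[folded lborel_prod]] by simp

lemma g_bound_left:
  "AE w in lborel. AE z in lborel. norm (g (z, w)) \<le> exp (pi * (norm z)\<^sup>2 / 2) * h (z - w)"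
proof -
  have "Measurable.pred (lborel \<Otimes>\<^sub>M lborel)
      (\<lambda>x. norm (g (fst x, snd x)) \<le> exp (pi * (norm (fst x))\<^sup>2 / 2) * h (fst x - snd x))"
    by measurable
  from lborel_pair.AE_commute[OF this[unfolded pred_def]] g_bound_right show ?thesis by simp
qed

text \<open>
  As a function of \<open>w\<close> this is both bounded by the mass of \<open>h\<close> and integrable, whereas \<open>h (z0 - w)\<close>
  itself is merely integrable and for \<open>p < \<infinity>\<close> cannot be paired with every element of \<open>L\<^sup>p\<close>.
\<close>
definition local_mass :: "complex ^ 'd \<Rightarrow> complex ^ 'd \<Rightarrow> ennreal" where
  "local_mass z0 w = (\<integral>\<^sup>+ z. ennreal (h (z - w)) * indicator (ball z0 3) z \<partial>lborel)"

lemma local_mass_measurable [measurable]: "local_mass z0 \<in> borel_measurable borel"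
proof -
  have [measurable]: "ball z0 3 \<in> sets borel" by simp
  show ?thesis unfolding local_mass_def by measurable
qed

lemma local_mass_le: "local_mass z0 w \<le> ennreal mass"
  unfolding local_mass_def nn_integral_h_left[of w, symmetric]
  by (intro nn_integral_mono) (simp add: indicator_def)

lemma nn_integral_local_mass:
  "(\<integral>\<^sup>+ w. local_mass z0 w \<partial>lborel) = ennreal mass * emeasure lborel (ball z0 3)"
proof -
  have [measurable]: "ball z0 3 \<in> sets borel" by simp
  have "(\<integral>\<^sup>+ w. local_mass z0 w \<partial>lborel)
      = (\<integral>\<^sup>+ z. \<integral>\<^sup>+ w. ennreal (h (z - w)) * indicator (ball z0 3) z \<partial>lborel \<partial>lborel)"
    unfolding local_mass_def by (rule lborel_pair.Fubini'[symmetric]) measurable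
  also have "\<dots> = (\<integral>\<^sup>+ z. ennreal mass * indicator (ball z0 3) z \<partial>lborel)"
    by (simp add: nn_integral_multc nn_integral_h_right)
  also have "\<dots> = ennreal mass * emeasure lborel (ball z0 3)"
    by (rule nn_integral_cmult_indicator) simp
  finally show ?thesis .
qed

text \<open>
  For almost every \<open>w\<close> the bound of the kernel by \<open>h\<close> is known at almost every \<open>z\<close> only. Inserted
  into the sub-mean value property on unit balls, it yields a bound at every \<open>z\<close>.
\<close>
lemma g_locally_bounded:
  "\<exists>C\<ge>0. AE w in lborel. \<forall>z\<in>cball z0 2. norm (g (z, w)) \<le> C * enn2real (local_mass z0 w)"
proof -
  define b where "b = measure lborel (ball (0 :: complex ^ 'd) 1)"
  have b: "0 < b" "emeasure lborel (ball (0 :: complex ^ 'd) 1) = ennreal b"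
    using emeasure_lborel_ball_finite[of "0 :: complex ^ 'd" 1]
    by (auto simp: b_def content_ball_pos emeasure_eq_ennreal_measure)
  have [measurable]: "ball z0 3 \<in> sets borel" by simp
  \<comment> \<open>A unit ball about a point of \<open>cball z0 2\<close> lies in \<open>ball z0 3\<close>, where \<open>E\<close> bounds the Gaussian factor.\<close>
  define E where "E = exp (pi * (norm z0 + 3)\<^sup>2 / 2)"
  have "AE w in lborel. \<forall>z\<in>cball z0 2. norm (g (z, w)) \<le> E / b * enn2real (local_mass z0 w)"
    using g_analytic g_bound_left
  proof eventually_elim
    case (elim w)
    show ?case
    proof
      fix z assume z: "z \<in> cball z0 2"
      have "ennreal (b * norm (g (z, w)))
          \<le> (\<integral>\<^sup>+ z'. ennreal (norm (g (z', w))) * indicator (ball z 1) z' \<partial>lborel)"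
        using analytic_Cd_sub_mean_value[OF elim(1), of 1 z] b by (simp add: ennreal_mult)
      also have "\<dots> \<le> (\<integral>\<^sup>+ z'. ennreal E * (ennreal (h (z' - w)) * indicator (ball z0 3) z') \<partial>lborel)"
        using elim(2)
      proof (intro nn_integral_mono_AE, eventually_elim)
        fix z'
        assume *: "norm (g (z', w)) \<le> exp (pi * (norm z')\<^sup>2 / 2) * h (z' - w)"
        show "ennreal (norm (g (z', w))) * indicator (ball z 1) z'
            \<le> ennreal E * (ennreal (h (z' - w)) * indicator (ball z0 3) z')"
        proof (cases "z' \<in> ball z 1")
          case True
          then have z': "dist z0 z' < 3" using z dist_triangle[of z0 z' z] by simp
          then have "norm z' \<le> norm z0 + 3"
            using norm_triangle_ineq2[of z' z0] by (simp add: dist_norm norm_minus_commute)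
          then have "exp (pi * (norm z')\<^sup>2 / 2) \<le> E"
            unfolding E_def by (simp add: power_mono)
          then have "norm (g (z', w)) \<le> E * h (z' - w)"
            using * mult_right_mono[OF _ h_nonneg[of "z' - w"]] by fastforce
          then show ?thesis
            using True z' by (simp add: E_def ennreal_mult[symmetric] h_nonneg ennreal_leI)
        qed simp
      qed
      also have "\<dots> = ennreal E * local_mass z0 w"
        unfolding local_mass_def by (rule nn_integral_cmult) measurable
      also have "\<dots> = ennreal (E * enn2real (local_mass z0 w))"
        using local_mass_le[of z0 w]
        by (simp add: E_def ennreal_mult ennreal_enn2real le_less_trans[OF _ ennreal_less_top])
      finally have "b * norm (g (z, w)) \<le> E * enn2real (local_mass z0 w)"
        by (simp add: E_def)
      then show "norm (g (z, w)) \<le> E / b * enn2real (local_mass z0 w)"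
        using b by (simp add: field_simps)
    qed
  qed
  moreover have "0 \<le> E / b" using b by (simp add: E_def)
  ultimately show ?thesis by blast
qed

text \<open>
  The condition on \<open>f\<close> places it in \<open>L\<^sup>\<infinity> + L\<^sup>1\<close>, which contains every \<open>L\<^sup>p\<close>: the exponents \<open>p < \<infinity>\<close>
  enter through \<open>|f| \<le> 1 + |f|\<^sup>p\<close>. The bounded part is paired with the integrability of
  \<open>local_mass z0\<close>, the integrable part with its boundedness.
\<close>
lemma integrand_locally_dominated:
  assumes f [measurable]: "f \<in> borel_measurable borel"
    and S: "0 \<le> S" and u: "integrable lborel u"
    and fS: "AE w in lborel. norm (f w) \<le> S + \<bar>u w\<bar>"
  shows "\<exists>G. integrable lborel G \<and> (AE w in lborel. \<forall>z\<in>cball z0 2. norm (f w * g (z, w)) \<le> G w)"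
proof -
  obtain C where C: "0 \<le> C"
    "AE w in lborel. \<forall>z\<in>cball z0 2. norm (g (z, w)) \<le> C * enn2real (local_mass z0 w)"
    using g_locally_bounded by blast
  have [measurable]: "u \<in> borel_measurable borel" using u by auto
  have fin: "ennreal (enn2real (local_mass z0 w)) = local_mass z0 w" for w
    using local_mass_le[of z0 w] by (intro ennreal_enn2real) (simp add: le_less_trans[OF _ ennreal_less_top])
  have "(\<integral>\<^sup>+ w. ennreal (norm (norm (f w) * enn2real (local_mass z0 w))) \<partial>lborel)
      \<le> (\<integral>\<^sup>+ w. ennreal S * local_mass z0 w + ennreal mass * ennreal (norm (u w)) \<partial>lborel)"
    using fS
  proof (intro nn_integral_mono_AE, eventually_elim)
    fix w assume *: "norm (f w) \<le> S + \<bar>u w\<bar>"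
    have "ennreal (norm (norm (f w) * enn2real (local_mass z0 w))) = ennreal (norm (f w)) * local_mass z0 w"
      by (simp add: ennreal_mult fin)
    also have "\<dots> \<le> (ennreal S + ennreal (norm (u w))) * local_mass z0 w"
      using * S by (intro mult_right_mono) (simp_all add: ennreal_plus[symmetric] ennreal_leI del: ennreal_plus)
    also have "\<dots> \<le> ennreal S * local_mass z0 w + ennreal mass * ennreal (norm (u w))"
      by (simp add: distrib_right mult.commute[of "ennreal mass"] mult_left_mono add_left_mono local_mass_le)
    finally show "ennreal (norm (norm (f w) * enn2real (local_mass z0 w)))
      \<le> ennreal S * local_mass z0 w + ennreal mass * ennreal (norm (u w))" .
  qed
  also have "\<dots> = ennreal S * (ennreal mass * emeasure lborel (ball z0 3))
      + ennreal mass * (\<integral>\<^sup>+ w. ennreal (norm (u w)) \<partial>lborel)"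
    by (simp add: nn_integral_add nn_integral_cmult nn_integral_local_mass)
  also have "\<dots> < \<infinity>"
    using u emeasure_lborel_ball_finite[of z0 3] unfolding integrable_iff_bounded
    by (simp add: ennreal_mult_less_top)
  finally have "integrable lborel (\<lambda>w. norm (f w) * enn2real (local_mass z0 w))"
    by (intro integrableI_bounded) auto
  then have "integrable lborel (\<lambda>w. C * (norm (f w) * enn2real (local_mass z0 w)))" by simp
  moreover have "AE w in lborel. \<forall>z\<in>cball z0 2.
      norm (f w * g (z, w)) \<le> C * (norm (f w) * enn2real (local_mass z0 w))"
    using C(2)
  proof eventually_elim
    case (elim w)
    then show ?case
      using mult_left_mono[OF _ norm_ge_zero[of "f w"]] by (fastforce simp: norm_mult mult_ac)
  qed
  ultimately show ?thesis by blast
qed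

lemma integral_operator:
  assumes f [measurable]: "f \<in> borel_measurable borel"
    and S: "0 \<le> S" and u: "integrable lborel u"
    and fS: "AE w in lborel. norm (f w) \<le> S + \<bar>u w\<bar>"
  shows integrable_integrand: "integrable lborel (\<lambda>w. f w * g (z, w))"
    and analytic_integral: "analytic_Cd (\<lambda>z. \<integral>w. f w * g (z, w) \<partial>lborel)"
proof -
  note dom = integrand_locally_dominated[OF assms]
  obtain G where "integrable lborel G" "AE w in lborel. \<forall>z\<in>cball z 2. norm (f w * g (z, w)) \<le> G w"
    using dom[of z] by blast
  then show "integrable lborel (\<lambda>w. f w * g (z, w))"
    by (elim Bochner_Integration.integrable_bound)
       (auto elim!: eventually_mono intro: order_trans[OF _ abs_ge_self])
  show "analytic_Cd (\<lambda>z. \<integral>w. f w * g (z, w) \<partial>lborel)"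
  proof (rule analytic_Cd_integral)
    show "AE w in lborel. analytic_Cd (\<lambda>z. f w * g (z, w))"
      using g_analytic by eventually_elim (rule analytic_Cd_cmult)
  qed (use dom in auto)
qed

text \<open>
  After multiplication by the Gaussian weight the output is dominated by the convolution of \<open>|f|\<close>
  with \<open>h\<close>; this already holds for almost every \<open>z\<close> by the hypothesis on the kernel.
\<close>
lemma integral_operator_bound:
  assumes f [measurable]: "f \<in> borel_measurable borel"
    and int: "\<And>z. integrable lborel (\<lambda>w. f w * g (z, w))"
  shows "AE z in lborel. ennreal (norm ((\<integral>w. f w * g (z, w) \<partial>lborel) * of_real (exp (- pi * (norm z)\<^sup>2 / 2))))
           \<le> (\<integral>\<^sup>+ w. ennreal (norm (f w) * h (z - w)) \<partial>lborel)"
  using g_bound_right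
proof eventually_elim
  case (elim z)
  let ?e = "exp (- pi * (norm z)\<^sup>2 / 2)"
  have "ennreal (norm ((\<integral>w. f w * g (z, w) \<partial>lborel) * of_real ?e))
      = ennreal (norm (\<integral>w. f w * g (z, w) * of_real ?e \<partial>lborel))"
    by simp
  also have "\<dots> \<le> (\<integral>\<^sup>+ w. ennreal (norm (f w * g (z, w) * of_real ?e)) \<partial>lborel)"
    by (intro integral_norm_bound_ennreal integrable_mult_left int)
  also have "\<dots> \<le> (\<integral>\<^sup>+ w. ennreal (norm (f w) * h (z - w)) \<partial>lborel)"
    using elim
  proof (intro nn_integral_mono_AE, eventually_elim)
    fix w assume "norm (g (z, w)) \<le> exp (pi * (norm z)\<^sup>2 / 2) * h (z - w)"
    then have "norm (g (z, w)) * ?e \<le> exp (pi * (norm z)\<^sup>2 / 2) * h (z - w) * ?e"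
      by (intro mult_right_mono) auto
    also have "\<dots> = h (z - w)" by (simp add: exp_minus field_simps)
    finally show "ennreal (norm (f w * g (z, w) * of_real ?e)) \<le> ennreal (norm (f w) * h (z - w))"
      by (intro ennreal_leI) (simp add: norm_mult mult.assoc mult_left_mono)
  qed
  finally show ?case .
qed

text \<open>
  Young's inequality for \<open>L\<^sup>p * L\<^sup>1\<close>: Jensen's inequality for the density \<open>w \<mapsto> h (z - w)\<close>,
  followed by integration over \<open>z\<close> and Tonelli's theorem. The constant is \<open>mass + 1\<close>, not
  \<open>mass\<close>, in order to be positive.
\<close>
lemma convolution_Lp:
  fixes f :: "complex ^ 'd \<Rightarrow> real"
  assumes r: "1 \<le> r" and f_nonneg: "\<And>w. 0 \<le> f w" and f [measurable]: "f \<in> borel_measurable borel"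
    and fr: "integrable lborel (\<lambda>w. f w powr r)"
  shows "AE z in lborel. integrable lborel (\<lambda>w. f w * h (z - w))"
    and "(\<integral>\<^sup>+ z. ennreal ((\<integral>w. f w * h (z - w) \<partial>lborel) powr r) \<partial>lborel)
           \<le> ennreal ((mass + 1) powr r * (\<integral>w. f w powr r \<partial>lborel))"
proof -
  let ?A = "mass + 1"
  have I: "(\<integral>\<^sup>+ z. \<integral>\<^sup>+ w. ennreal (f w powr r * h (z - w)) \<partial>lborel \<partial>lborel)
      = ennreal (mass * (\<integral>w. f w powr r \<partial>lborel))"
  proof -
    have "(\<integral>\<^sup>+ z. \<integral>\<^sup>+ w. ennreal (f w powr r * h (z - w)) \<partial>lborel \<partial>lborel)
        = (\<integral>\<^sup>+ w. \<integral>\<^sup>+ z. ennreal (f w powr r * h (z - w)) \<partial>lborel \<partial>lborel)"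
      by (rule lborel_pair.Fubini'[symmetric]) measurable
    also have "\<dots> = (\<integral>\<^sup>+ w. ennreal (f w powr r) * ennreal mass \<partial>lborel)"
      by (simp add: ennreal_mult h_nonneg nn_integral_cmult nn_integral_h_left)
    also have "\<dots> = (\<integral>\<^sup>+ w. ennreal (f w powr r) \<partial>lborel) * ennreal mass"
      by (rule nn_integral_multc) measurable
    also have "(\<integral>\<^sup>+ w. ennreal (f w powr r) \<partial>lborel) = ennreal (\<integral>w. f w powr r \<partial>lborel)"
      by (intro nn_integral_eq_integral fr) simp
    finally show ?thesis by (simp add: ennreal_mult'' mass_nonneg mult.commute)
  qed
  have h_int: "integrable lborel (\<lambda>w. h (z - w))" "(\<integral>w. h (z - w) \<partial>lborel) \<le> ?A" for z
  proof -
    show i: "integrable lborel (\<lambda>w. h (z - w))"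
      using nn_integral_h_right[of z] by (intro integrableI_nonneg) (auto simp: h_nonneg)
    have "ennreal (\<integral>w. h (z - w) \<partial>lborel) = ennreal mass"
      using nn_integral_eq_integral[OF i] by (simp add: h_nonneg nn_integral_h_right)
    then have "(\<integral>w. h (z - w) \<partial>lborel) = mass"
      by (subst (asm) ennreal_inj) (simp_all add: h_nonneg mass_nonneg)
    then show "(\<integral>w. h (z - w) \<partial>lborel) \<le> ?A" by simp
  qed
  have "AE z in lborel. (\<integral>\<^sup>+ w. ennreal (f w powr r * h (z - w)) \<partial>lborel) \<noteq> \<infinity>"
    by (rule nn_integral_PInf_AE) (use I in \<open>simp_all\<close>)
  then have int_r: "AE z in lborel. integrable lborel (\<lambda>w. f w powr r * h (z - w))"
    by eventually_elim (auto intro!: integrableI_nonneg simp: h_nonneg less_top)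
  then show "AE z in lborel. integrable lborel (\<lambda>w. f w * h (z - w))"
  proof eventually_elim
    case (elim z)
    show ?case
      by (rule Jensen_powr_integral(1)[OF r _ h_int(2) f_nonneg h_nonneg _ h_int(1) elim])
         (use mass_nonneg in auto)
  qed
  have "(\<integral>\<^sup>+ z. ennreal ((\<integral>w. f w * h (z - w) \<partial>lborel) powr r) \<partial>lborel)
      \<le> (\<integral>\<^sup>+ z. ennreal (?A powr (r - 1)) * (\<integral>\<^sup>+ w. ennreal (f w powr r * h (z - w)) \<partial>lborel) \<partial>lborel)"
    using int_r
  proof (intro nn_integral_mono_AE, eventually_elim)
    case (elim z)
    have "(\<integral>w. f w * h (z - w) \<partial>lborel) powr r
        \<le> ?A powr (r - 1) * (\<integral>w. f w powr r * h (z - w) \<partial>lborel)"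
      by (rule Jensen_powr_integral(2)[OF r _ h_int(2) f_nonneg h_nonneg _ h_int(1) elim(2)])
         (use mass_nonneg in auto)
    then show ?case
      using nn_integral_eq_integral[OF elim(2)]
      by (simp add: h_nonneg ennreal_mult'[symmetric] ennreal_leI)
  qed
  also have "\<dots> = ennreal (?A powr (r - 1)) * (\<integral>\<^sup>+ z. \<integral>\<^sup>+ w. ennreal (f w powr r * h (z - w)) \<partial>lborel \<partial>lborel)"
    by (rule nn_integral_cmult) measurable
  also have "\<dots> = ennreal (?A powr (r - 1) * (mass * (\<integral>w. f w powr r \<partial>lborel)))"
    unfolding I by (simp add: ennreal_mult')
  also have "\<dots> \<le> ennreal (?A powr r * (\<integral>w. f w powr r \<partial>lborel))"
  proof (rule ennreal_leI)
    have "?A powr (r - 1) * (mass * (\<integral>w. f w powr r \<partial>lborel))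
        \<le> ?A powr (r - 1) * (?A * (\<integral>w. f w powr r \<partial>lborel))"
      by (intro mult_left_mono mult_right_mono) auto
    also have "\<dots> = ?A powr r * (\<integral>w. f w powr r \<partial>lborel)"
      using mass_nonneg by (simp add: powr_diff)
    finally show "?A powr (r - 1) * (mass * (\<integral>w. f w powr r \<partial>lborel)) \<le> ?A powr r * (\<integral>w. f w powr r \<partial>lborel)" .
  qed
  finally show "(\<integral>\<^sup>+ z. ennreal ((\<integral>w. f w * h (z - w) \<partial>lborel) powr r) \<partial>lborel)
      \<le> ennreal (?A powr r * (\<integral>w. f w powr r \<partial>lborel))" .
qed

section \<open>Boundedness on Fock spaces\<close>

lemma bounded_fock_operator_of_dominated_kernel:
  assumes K: "\<And>F z w. fock_integrand K F z w = fock_weighted F w * g (z, w)" and p: "1 \<le> p"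
  shows "bounded_fock_operator p K"
proof -
  have op: "fock_operator K F = (\<lambda>z. \<integral>w. fock_weighted F w * g (z, w) \<partial>lborel)" for F
    by (rule ext) (simp add: fock_operator_def K)
  have key: "(\<forall>z. integrable lborel (fock_integrand K F z)) \<and> fock_operator K F \<in> fock_space p \<and>
      fock_norm p (fock_operator K F) \<le> (mass + 1) * fock_norm p F" if F: "F \<in> fock_space p" for F
  proof -
    let ?f = "fock_weighted F" and ?G = "fock_weighted (fock_operator K F)"
    have Lp: "in_Lp p ?f" using F by (simp add: fock_space_def)
    then have f [measurable]: "?f \<in> borel_measurable borel" by (simp add: in_Lp_def)
    have A: "0 < mass + 1" using mass_nonneg by simp
    \<comment> \<open>The weighted function is split as in \<open>integrand_locally_dominated\<close>; for \<open>p = \<infinity>\<close> the constant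
      part must be the norm itself, since it also gives the operator bound.\<close>
    obtain S u where S: "0 \<le> S" and u: "integrable lborel u"
      and fS: "AE w in lborel. norm (?f w) \<le> S + \<bar>u w\<bar>"
      and S_top: "p = \<infinity> \<longrightarrow> S = fock_norm p F \<and> u = (\<lambda>_. 0)"
    proof (cases "p = \<infinity>")
      case True
      have "AE w in lborel. norm (?f w) \<le> fock_norm p F + \<bar>0 :: real\<bar>"
        using esssup_AE[of "\<lambda>w. ennreal (norm (?f w))" lborel]
      proof eventually_elim
        case (elim w)
        then show ?case
          using Lp True by (simp add: in_Lp_def fock_norm_def Lp_norm_def enn2real_leI flip: ennreal_le_iff)
      qed
      moreover have "0 \<le> fock_norm p F" by (simp add: True fock_norm_def Lp_norm_def)
      ultimately show ?thesis using that[of "fock_norm p F" "\<lambda>_. 0"] by simp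
    next
      case False
      then have "1 \<le> enn2real p" using p by (cases p) auto
      then show ?thesis
        using that[of 1 "\<lambda>w. norm (?f w) powr enn2real p"] Lp False le_one_plus_powr
        by (simp add: in_Lp_def)
    qed
    note prem = f S u fS
    have int: "integrable lborel (\<lambda>w. ?f w * g (z, w))" for z
      by (rule integrable_integrand[OF prem])
    have an: "analytic_Cd (fock_operator K F)"
      unfolding op by (rule analytic_integral[OF prem])
    then have "fock_operator K F \<in> borel_measurable borel" by (rule analytic_Cd_measurable)
    then have G [measurable]: "?G \<in> borel_measurable borel"
      unfolding fock_weighted_def by measurable
    have G_bound: "AE z in lborel. ennreal (norm (?G z)) \<le> (\<integral>\<^sup>+ w. ennreal (norm (?f w) * h (z - w)) \<partial>lborel)"
      using integral_operator_bound[OF f int] by (simp add: fock_weighted_def op)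
    have "in_Lp p ?G \<and> Lp_norm p ?G \<le> (mass + 1) * Lp_norm p ?f"
    proof (cases "p = \<infinity>")
      case True
      have "AE z in lborel. ennreal (norm (?G z)) \<le> ennreal ((mass + 1) * S)"
        using G_bound
      proof eventually_elim
        case (elim z)
        also have "(\<integral>\<^sup>+ w. ennreal (norm (?f w) * h (z - w)) \<partial>lborel) \<le> (\<integral>\<^sup>+ w. ennreal S * ennreal (h (z - w)) \<partial>lborel)"
          using fS
        proof (intro nn_integral_mono_AE, eventually_elim)
          fix w assume "norm (?f w) \<le> S + \<bar>u w\<bar>"
          then show "ennreal (norm (?f w) * h (z - w)) \<le> ennreal S * ennreal (h (z - w))"
            using S S_top True by (simp add: ennreal_mult[symmetric] h_nonneg ennreal_leI mult_right_mono)
        qed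
        also have "\<dots> = ennreal S * ennreal mass"
          by (subst nn_integral_cmult) (simp_all add: nn_integral_h_right)
        also have "\<dots> \<le> ennreal ((mass + 1) * S)"
          using S mass_nonneg by (simp add: ennreal_mult[symmetric] ennreal_leI algebra_simps)
        finally show ?case .
      qed
      then have le: "esssup lborel (\<lambda>z. ennreal (norm (?G z))) \<le> ennreal ((mass + 1) * S)"
        by (intro esssup_I) auto
      have "0 \<le> (mass + 1) * S" using S A by simp
      then have "enn2real (esssup lborel (\<lambda>z. ennreal (norm (?G z)))) \<le> (mass + 1) * S"
        using le by (rule enn2real_leI)
      then show ?thesis
        using le S_top True
        by (auto simp: in_Lp_def Lp_norm_def fock_norm_def le_less_trans[OF _ ennreal_less_top])
    next
      case False
      define r where "r = enn2real p"
      have r: "1 \<le> r" using p False by (cases p) (auto simp: r_def)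
      have fr: "integrable lborel (\<lambda>w. norm (?f w) powr r)"
        using Lp False by (simp add: in_Lp_def r_def)
      note conv = convolution_Lp[OF r norm_ge_zero _ fr]
      have "(\<integral>\<^sup>+ z. ennreal (norm (?G z) powr r) \<partial>lborel)
          \<le> (\<integral>\<^sup>+ z. ennreal ((\<integral>w. norm (?f w) * h (z - w) \<partial>lborel) powr r) \<partial>lborel)"
      proof (rule nn_integral_mono_AE)
        have "AE z in lborel. integrable lborel (\<lambda>w. norm (?f w) * h (z - w))"
          by (rule conv) measurable
        with G_bound show "AE z in lborel. ennreal (norm (?G z) powr r)
            \<le> ennreal ((\<integral>w. norm (?f w) * h (z - w) \<partial>lborel) powr r)"
        proof eventually_elim
          case (elim z)
          have "(\<integral>\<^sup>+ w. ennreal (norm (?f w) * h (z - w)) \<partial>lborel) = ennreal (\<integral>w. norm (?f w) * h (z - w) \<partial>lborel)"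
            by (intro nn_integral_eq_integral elim) (simp add: h_nonneg)
          with elim(1) have "norm (?G z) \<le> (\<integral>w. norm (?f w) * h (z - w) \<partial>lborel)"
            by (simp add: h_nonneg)
          then show ?case using r by (intro ennreal_leI powr_mono2) auto
        qed
      qed
      also have "\<dots> \<le> ennreal ((mass + 1) powr r * (\<integral>w. norm (?f w) powr r \<partial>lborel))"
        by (rule conv) measurable
      finally have le: "(\<integral>\<^sup>+ z. ennreal (norm (?G z) powr r) \<partial>lborel)
          \<le> ennreal ((mass + 1) powr r * (\<integral>w. norm (?f w) powr r \<partial>lborel))" .
      have Gr: "integrable lborel (\<lambda>z. norm (?G z) powr r)"
        by (rule integrableI_nonneg) (use le in \<open>auto intro: le_less_trans\<close>)
      have "(\<integral>z. norm (?G z) powr r \<partial>lborel) \<le> (mass + 1) powr r * (\<integral>w. norm (?f w) powr r \<partial>lborel)"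
        using le nn_integral_eq_integral[OF Gr] by simp
      then have "(\<integral>z. norm (?G z) powr r \<partial>lborel) powr (1 / r)
          \<le> ((mass + 1) powr r * (\<integral>w. norm (?f w) powr r \<partial>lborel)) powr (1 / r)"
        using r by (intro powr_mono2) auto
      also have "\<dots> = (mass + 1) * (\<integral>w. norm (?f w) powr r \<partial>lborel) powr (1 / r)"
        using r A by (simp add: powr_mult powr_powr)
      finally show ?thesis
        using False Gr by (simp add: in_Lp_def Lp_norm_def r_def)
    qed
    then show ?thesis
      using int an by (simp add: K[abs_def] fock_space_def fock_norm_def)
  qed
  then show ?thesis unfolding bounded_fock_operator_def by blast
qed

end

theorem proposition4p4:
  fixes K\<^sub>T :: "(complex ^ 'd) \<times> (complex ^ 'd) \<Rightarrow> complex"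
    and H :: "complex ^ 'd \<Rightarrow> real"
  assumes "tempered_kernel K\<^sub>T"
    and "analytic_kernel K\<^sub>T"
    and "integrable lborel H"
    and "AE (z, w) in lborel. norm (K\<^sub>T (z, vcnj w))
           \<le> \<bar>exp (pi * ((norm z)\<^sup>2 + (norm w)\<^sup>2) / 2)\<bar> * H (z - w)"
  shows "(\<forall>p\<ge>1. bounded_fock_operator p K\<^sub>T) \<and> bounded_fock_operator 2 K\<^sub>T"
proof -
  \<comment> \<open>Half of the Gaussian in the integrand weights \<open>F\<close>, the other half is moved into the kernel.\<close>
  define e where "e w = exp (- pi * (norm w)\<^sup>2 / 2)" for w :: "complex ^ 'd"
  define g where "g x = (case x of (z, w) \<Rightarrow> K\<^sub>T (z, vcnj w)) * complex_of_real (e (snd x))" for x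
  interpret convolution_dominated_kernel g "\<lambda>x. \<bar>H x\<bar>"
  proof
    have "(\<lambda>x :: (complex ^ 'd) \<times> (complex ^ 'd). complex_of_real (e (snd x))) \<in> borel_measurable borel"
      unfolding e_def by (intro borel_measurable_continuous_onI continuous_intros) auto
    then show "g \<in> borel_measurable borel"
      unfolding g_def using tempered_kernel_measurable[OF assms(1)] by (intro borel_measurable_times)
    show "AE w in lborel. analytic_Cd (\<lambda>z. g (z, w))"
      using assms(2) unfolding analytic_kernel_def
    proof eventually_elim
      case (elim w)
      from analytic_Cd_cmult[OF this, of "of_real (e w)"] show ?case
        by (simp add: g_def mult.commute)
    qed
    show "AE x in lborel. norm (g x) \<le> exp (pi * (norm (fst x))\<^sup>2 / 2) * \<bar>H (fst x - snd x)\<bar>"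
      using assms(4)
    proof eventually_elim
      case (elim x)
      obtain z w where x: "x = (z, w)" by (cases x)
      have "norm (g x) = norm (K\<^sub>T (z, vcnj w)) * e w" by (simp add: g_def x norm_mult e_def)
      also have "\<dots> \<le> (exp (pi * ((norm z)\<^sup>2 + (norm w)\<^sup>2) / 2) * H (z - w)) * e w"
        using elim by (intro mult_right_mono) (simp_all add: x e_def)
      also have "\<dots> = exp (pi * ((norm z)\<^sup>2 + (norm w)\<^sup>2) / 2) * e w * H (z - w)" by simp
      also have "exp (pi * ((norm z)\<^sup>2 + (norm w)\<^sup>2) / 2) * e w = exp (pi * (norm z)\<^sup>2 / 2)"
        by (simp add: e_def mult_exp_exp add_divide_distrib distrib_left)
      also have "exp (pi * (norm z)\<^sup>2 / 2) * H (z - w) \<le> exp (pi * (norm z)\<^sup>2 / 2) * \<bar>H (z - w)\<bar>"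
        by (intro mult_left_mono) auto
      finally show ?case by (simp add: x)
    qed
  qed (use assms(3) in auto)
  have "fock_integrand K\<^sub>T F z w = fock_weighted F w * g (z, w)" for F z w
  proof -
    have "exp (- pi * (norm w)\<^sup>2) = exp (- pi * (norm w)\<^sup>2 / 2) * e w" by (simp add: e_def mult_exp_exp)
    then show ?thesis unfolding fock_integrand_def fock_weighted_def g_def by (simp add: mult_ac)
  qed
  then have "bounded_fock_operator p K\<^sub>T" if "1 \<le> p" for p
    using bounded_fock_operator_of_dominated_kernel that by blast
  then show ?thesis by simp
qed

end
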